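(* Let $r\in\mathbb{Q}\cap\,]0,+\infty[$. There exists a finite monoid $M$ such that $$r=\frac{|\mathrm{Aut}(M)|}{|M|},$$ where $\mathrm{Aut}(M)$ is the group of monoid automorphisms of $M$. Moreover, the monoid $M$ can be chosen to be commutative.
   Context: A monoid is a set with an associative binary operation having a neutral element. A monoid homomorphism is a map preserving the operation and sending the neutral element to the neutral element; $\mathrm{Aut}(M)$ is the automorphism group of $M$ in the resulting category. For a finite set $X$, $|X|$ denotes its number of elements. *)

theory Defs
  imports "HOL-Algebra.Algebra"
begin

text \<open>The library's \<open>hom\<close> does not ask for the neutral element to be preserved.\<close>

definition monoid_hom :: "('a, 'c) monoid_scheme \<Rightarrow> ('b, 'd) monoid_scheme \<Rightarrow> ('a \<Rightarrow> 'b) set" where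
  "monoid_hom M N = {f \<in> hom M N. f \<one>\<^bsub>M\<^esub> = \<one>\<^bsub>N\<^esub>}"

text \<open>
  The invertible endomorphisms of \<open>M\<close> in the category of monoids.  As in the library's
  \<open>Bij\<close> and \<open>auto\<close>, a map on the carrier is represented by its extensional
  representative, so that distinct elements are distinct maps on the carrier.
\<close>

definition monoid_auts :: "('a, 'c) monoid_scheme \<Rightarrow> ('a \<Rightarrow> 'a) set" where
  "monoid_auts M = {f \<in> monoid_hom M M \<inter> extensional (carrier M).
     \<exists>g \<in> monoid_hom M M. \<forall>x \<in> carrier M. g (f x) = x \<and> f (g x) = x}"

definition MonoidAut :: "('a, 'c) monoid_scheme \<Rightarrow> ('a \<Rightarrow> 'a) monoid" where
  "MonoidAut M = BijGroup (carrier M) \<lparr>carrier := monoid_auts M\<rparr>"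

lemma monoid_homD:
  assumes "f \<in> monoid_hom M N"
  shows "x \<in> carrier M \<Longrightarrow> f x \<in> carrier N"
    and "x \<in> carrier M \<Longrightarrow> y \<in> carrier M \<Longrightarrow> f (x \<otimes>\<^bsub>M\<^esub> y) = f x \<otimes>\<^bsub>N\<^esub> f y"
    and "f \<one>\<^bsub>M\<^esub> = \<one>\<^bsub>N\<^esub>"
  using assms by (auto simp: monoid_hom_def hom_def)

lemma monoid_auts_subset_Bij: "monoid_auts M \<subseteq> Bij (carrier M)"
proof
  fix f assume "f \<in> monoid_auts M"
  then obtain g where f: "f \<in> monoid_hom M M" "f \<in> extensional (carrier M)"
    and g: "g \<in> monoid_hom M M" "\<forall>x \<in> carrier M. g (f x) = x \<and> f (g x) = x"
    by (auto simp: monoid_auts_def)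
  have "bij_betw f (carrier M) (carrier M)"
    by (rule bij_betw_byWitness[where f' = g]) (use f g monoid_homD(1) in auto)
  with f show "f \<in> Bij (carrier M)" by (simp add: Bij_def)
qed

lemma (in monoid) restrict_monoid_hom:
  "f \<in> monoid_hom G G \<Longrightarrow> restrict f (carrier G) \<in> monoid_hom G G"
  by (auto simp: monoid_hom_def hom_def)

lemma (in monoid) compose_monoid_hom:
  "f \<in> monoid_hom G G \<Longrightarrow> g \<in> monoid_hom G G \<Longrightarrow> compose (carrier G) f g \<in> monoid_hom G G"
  by (auto simp: monoid_hom_def hom_def compose_def Pi_iff)

lemma (in monoid) subgroup_monoid_auts: "subgroup (monoid_auts G) (BijGroup (carrier G))"
proof (rule group.subgroupI[OF group_BijGroup])
  show "monoid_auts G \<subseteq> carrier (BijGroup (carrier G))"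
    using monoid_auts_subset_Bij by (auto simp: BijGroup_def)
  have "(\<lambda>x. x) \<in> monoid_hom G G"
    by (auto simp: monoid_hom_def hom_def)
  then have "restrict (\<lambda>x. x) (carrier G) \<in> monoid_auts G"
    using restrict_monoid_hom[of "\<lambda>x. x"] by (auto simp: monoid_auts_def)
  then show "monoid_auts G \<noteq> {}" by blast
next
  fix f assume f: "f \<in> monoid_auts G"
  then have fB: "f \<in> Bij (carrier G)" using monoid_auts_subset_Bij by blast
  from f obtain g where g: "f \<in> monoid_hom G G" "g \<in> monoid_hom G G"
    "\<forall>x \<in> carrier G. g (f x) = x \<and> f (g x) = x"
    by (auto simp: monoid_auts_def)
  have inj: "inj_on f (carrier G)" using fB by (auto simp: Bij_def bij_betw_def)
  have "inv_into (carrier G) f x = g x" if "x \<in> carrier G" for x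
    using g that inv_into_f_f[OF inj] monoid_homD(1)[OF g(2)] by metis
  then have "inv\<^bsub>BijGroup (carrier G)\<^esub> f = restrict g (carrier G)"
    using fB by (auto simp: inv_BijGroup intro!: restrict_ext)
  moreover have "restrict g (carrier G) \<in> monoid_auts G"
    using g restrict_monoid_hom[OF g(2)] monoid_homD(1)[OF g(1)]
    by (auto simp: monoid_auts_def intro!: bexI[of _ f])
  ultimately show "inv\<^bsub>BijGroup (carrier G)\<^esub> f \<in> monoid_auts G" by simp
next
  fix f f' assume a: "f \<in> monoid_auts G" "f' \<in> monoid_auts G"
  then have B: "f \<in> Bij (carrier G)" "f' \<in> Bij (carrier G)"
    using monoid_auts_subset_Bij by auto
  obtain g where g: "f \<in> monoid_hom G G" "g \<in> monoid_hom G G"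
    "\<forall>x \<in> carrier G. g (f x) = x \<and> f (g x) = x"
    using a by (auto simp: monoid_auts_def)
  obtain g' where g': "f' \<in> monoid_hom G G" "g' \<in> monoid_hom G G"
    "\<forall>x \<in> carrier G. g' (f' x) = x \<and> f' (g' x) = x"
    using a by (auto simp: monoid_auts_def)
  have "compose (carrier G) f f' \<in> monoid_auts G"
    unfolding monoid_auts_def
    using g g' compose_monoid_hom[OF g(1) g'(1)] compose_monoid_hom[OF g'(2) g(2)]
      monoid_homD(1)[OF g(1)] monoid_homD(1)[OF g(2)] monoid_homD(1)[OF g'(1)]
      monoid_homD(1)[OF g'(2)]
    by (auto simp: compose_def intro!: bexI[of _ "compose (carrier G) g' g"])
  then show "f \<otimes>\<^bsub>BijGroup (carrier G)\<^esub> f' \<in> monoid_auts G"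
    using B by (simp add: BijGroup_def)
qed

lemma (in monoid) group_MonoidAut: "group (MonoidAut G)"
  unfolding MonoidAut_def
  by (rule subgroup.subgroup_is_group[OF subgroup_monoid_auts group_BijGroup])

end

theory Submission
  imports Defs
begin

text \<open>
  Adjoin a least element and a greatest element to an antichain of \<open>n\<close> points, and then
  put a finite chain on top.  The result is a join semilattice with a least element, hence a finite
  commutative monoid.  When \<open>n > 0\<close>, an automorphism fixes the least element and
  every point above the antichain, because such a point is determined by the number of
  elements that it absorbs; the points of the antichain, on the other hand, can be permuted
  at will.  So there are exactly \<open>n!\<close> automorphisms, while the length of the chain can
  be chosen to give the monoid any order \<open>N \<ge> n + 2\<close>.

  For \<open>r = a / b\<close> it remains to write \<open>n! = a k\<close> and to take \<open>N = b k\<close>.  Factorials grow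
  so fast that \<open>n = a + 4\<close> already makes \<open>k\<close> at least \<open>n + 2\<close>.
\<close>

section \<open>A semilattice with an antichain and a chain\<close>

text \<open>
  The antichain is \<open>{1..n}\<close>; the least element is \<open>0\<close>, and \<open>n + 1 < n + 2 < \<dots>\<close> is
  the chain, so that two distinct nonzero elements always have their join in the chain.
\<close>

definition antichain_join :: "nat \<Rightarrow> nat \<Rightarrow> nat \<Rightarrow> nat" where
  "antichain_join n x y =
     (if x = 0 then y else if y = 0 \<or> x = y then x else max (n + 1) (max x y))"

definition antichain_monoid :: "nat \<Rightarrow> nat \<Rightarrow> nat monoid" where
  "antichain_monoid n N = \<lparr>carrier = {..<N}, monoid.mult = antichain_join n, one = 0\<rparr>"

lemma antichain_monoid_simps [simp]:
  "carrier (antichain_monoid n N) = {..<N}"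
  "x \<otimes>\<^bsub>antichain_monoid n N\<^esub> y = antichain_join n x y"
  "\<one>\<^bsub>antichain_monoid n N\<^esub> = 0"
  by (simp_all add: antichain_monoid_def)

lemma comm_monoid_antichain_monoid:
  assumes "n + 2 \<le> N"
  shows "comm_monoid (antichain_monoid n N)"
  by (rule comm_monoidI) (use assms in \<open>auto simp: antichain_join_def max_def\<close>)

section \<open>Its automorphisms\<close>

text \<open>
  The number of elements absorbed by \<open>x\<close> is an invariant of \<open>x\<close> under automorphisms of any
  monoid.
\<close>

lemma monoid_auts_card_absorbed:
  assumes f: "f \<in> monoid_auts M" and x: "x \<in> carrier M"
  shows "card {y \<in> carrier M. y \<otimes>\<^bsub>M\<^esub> f x = f x} = card {y \<in> carrier M. y \<otimes>\<^bsub>M\<^esub> x = x}"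
proof -
  obtain g where fh: "f \<in> monoid_hom M M" and gh: "g \<in> monoid_hom M M"
    and inv: "\<And>y. y \<in> carrier M \<Longrightarrow> g (f y) = y" "\<And>y. y \<in> carrier M \<Longrightarrow> f (g y) = y"
    using f by (auto simp: monoid_auts_def)
  note fD = monoid_homD[OF fh] and gD = monoid_homD[OF gh]
  have "bij_betw f {y \<in> carrier M. y \<otimes>\<^bsub>M\<^esub> x = x} {y \<in> carrier M. y \<otimes>\<^bsub>M\<^esub> f x = f x}"
  proof (rule bij_betw_byWitness[where f' = g])
    show "f ` {y \<in> carrier M. y \<otimes>\<^bsub>M\<^esub> x = x} \<subseteq> {y \<in> carrier M. y \<otimes>\<^bsub>M\<^esub> f x = f x}"
      using fD(1) fD(2)[of _ x] x by force
    show "g ` {y \<in> carrier M. y \<otimes>\<^bsub>M\<^esub> f x = f x} \<subseteq> {y \<in> carrier M. y \<otimes>\<^bsub>M\<^esub> x = x}"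
    proof clarify
      fix y assume y: "y \<in> carrier M" "y \<otimes>\<^bsub>M\<^esub> f x = f x"
      have "g y \<otimes>\<^bsub>M\<^esub> x = g (y \<otimes>\<^bsub>M\<^esub> f x)"
        using gD(2)[OF y(1) fD(1)[OF x]] inv(1)[OF x] by simp
      then show "g y \<in> carrier M \<and> g y \<otimes>\<^bsub>M\<^esub> x = x"
        using y inv(1)[OF x] gD(1) by simp
    qed
  qed (use inv in auto)
  then show ?thesis by (rule bij_betw_same_card[symmetric])
qed

lemma antichain_absorbed:
  assumes "x < N"
  shows "{y \<in> {..<N}. antichain_join n y x = x} = (if x \<le> n then {0, x} else {..x})"
  using assms by (auto simp: antichain_join_def max_def split: if_splits)

lemma antichain_auts_fix_chain:
  assumes f: "f \<in> monoid_auts (antichain_monoid n N)" and n: "0 < n" and x: "n < x" "x < N"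
  shows "f x = x"
proof -
  have fx: "f x < N"
    using f x monoid_homD(1)[of f "antichain_monoid n N" "antichain_monoid n N" x]
    by (auto simp: monoid_auts_def)
  have "card {y \<in> {..<N}. antichain_join n y (f x) = f x} = card {y \<in> {..<N}. antichain_join n y x = x}"
    using monoid_auts_card_absorbed[OF f, of x] x by simp
  then have card_eq: "card (if f x \<le> n then {0, f x} else {..f x}) = x + 1"
    unfolding antichain_absorbed[OF fx] antichain_absorbed[OF x(2)] using x by simp
  \<comment> \<open>An element outside the chain absorbs at most two elements, and \<open>x\<close> absorbs at least three.\<close>
  have "card {0, f x} \<le> 2" by (simp add: card_insert_if)
  with card_eq n x show ?thesis by (auto split: if_splits)
qed

lemma permutes_is_antichain_hom:
  assumes p: "p permutes {1..n}" and N: "n + 2 \<le> N"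
  shows "p \<in> monoid_hom (antichain_monoid n N) (antichain_monoid n N)"
proof -
  have p0: "p 0 = 0" and pfix: "\<And>x. n < x \<Longrightarrow> p x = x"
    using p by (auto simp: permutes_def)
  have ple: "p x \<le> n" if "x \<le> n" for x
    using permutes_in_image[OF p, of x] p0 that by (cases "x = 0") auto
  have inj: "p x = p y \<longleftrightarrow> x = y" for x y
    using permutes_inj[OF p] by (auto simp: inj_eq)
  have zero: "p x = 0 \<longleftrightarrow> x = 0" for x using inj[of x 0] p0 by simp
  \<comment> \<open>Joins of distinct nonzero elements see the elements of the antichain only through this
      maximum.\<close>
  have pmax: "max (n + 1) (p x) = max (n + 1) x" for x
    using ple[of x] pfix[of x] by (cases "x \<le> n") auto
  have "p (antichain_join n x y) = antichain_join n (p x) (p y)" for x y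
  proof -
    have "max (n + 1) (max (p x) (p y)) = max (n + 1) (max x y)"
      using pmax[of x] pmax[of y] by (metis max.assoc max.left_commute)
    then show ?thesis by (auto simp: antichain_join_def inj zero p0 pfix)
  qed
  moreover have "p x < N" if "x < N" for x
    using ple[of x] pfix[of x] that N by (cases "x \<le> n") auto
  ultimately show ?thesis by (auto simp: monoid_hom_def hom_def p0)
qed

lemma antichain_monoid_auts_eq:
  assumes n: "0 < n" and N: "n + 2 \<le> N"
  shows "monoid_auts (antichain_monoid n N) = (\<lambda>p. restrict p {..<N}) ` {p. p permutes {1..n}}"
    (is "?A = ?R")
proof
  let ?M = "antichain_monoid n N"
  interpret comm_monoid ?M by (rule comm_monoid_antichain_monoid[OF N])
  show "?R \<subseteq> ?A"
  proof clarify
    fix p assume p: "p permutes {1..n}"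
    let ?q = "inv_into UNIV p"
    have ph: "p \<in> monoid_hom ?M ?M" and qh: "?q \<in> monoid_hom ?M ?M"
      using permutes_is_antichain_hom[OF _ N] p permutes_inv[OF p] by auto
    have "restrict p {..<N} \<in> monoid_hom ?M ?M"
      using restrict_monoid_hom[OF ph] by simp
    then show "restrict p {..<N} \<in> ?A"
      using qh monoid_homD(1)[OF qh] permutes_inverses[OF p]
      by (auto simp: monoid_auts_def intro!: bexI[of _ ?q])
  qed
  show "?A \<subseteq> ?R"
  proof
    fix f assume f: "f \<in> ?A"
    define p where "p x = (if x < N then f x else x)" for x
    have fh: "f \<in> monoid_hom ?M ?M" and ext: "f \<in> extensional {..<N}"
      using f by (auto simp: monoid_auts_def)
    have "bij_betw f {..<N} {..<N}"
      using f monoid_auts_subset_Bij[of ?M] by (auto simp: Bij_def)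
    then have "bij_betw p {..<N} {..<N}"
      by (subst bij_betw_cong[of _ p f]) (auto simp: p_def)
    then have "p permutes {..<N}"
      by (rule bij_imp_permutes) (simp add: p_def)
    moreover have "p x = x" if "x \<in> {..<N} - {1..n}" for x
    proof (cases "x = 0")
      case True
      then show ?thesis using monoid_homD(3)[OF fh] by (simp add: p_def)
    next
      case False
      then show ?thesis
        using that antichain_auts_fix_chain[OF f n] by (auto simp: p_def)
    qed
    ultimately have "p permutes {1..n}"
      by (rule permutes_superset)
    moreover have "f = restrict p {..<N}"
      using ext by (auto simp: p_def extensional_def)
    ultimately show "f \<in> ?R" by blast
  qed
qed

lemma order_MonoidAut_antichain_monoid:
  assumes n: "0 < n" and N: "n + 2 \<le> N"
  shows "order (MonoidAut (antichain_monoid n N)) = fact n"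
proof -
  have "inj_on (\<lambda>p. restrict p {..<N}) {p. p permutes {1..n}}"
  proof (rule inj_onI, rule ext)
    fix p q x
    assume pq: "p \<in> {p. p permutes {1..n}}" "q \<in> {p. p permutes {1..n}}"
      and eq: "restrict p {..<N} = restrict q {..<N}"
    show "p x = q x"
    proof (cases "x < N")
      case True
      then show ?thesis using fun_cong[OF eq, of x] by simp
    next
      case False
      then have "x \<notin> {1..n}" using N by simp
      then show ?thesis using pq by (auto simp: permutes_def)
    qed
  qed
  then have "card (monoid_auts (antichain_monoid n N)) = card {p. p permutes {1..n}}"
    by (simp add: antichain_monoid_auts_eq[OF n N] card_image)
  also have "\<dots> = fact n" by (rule card_permutations) auto
  finally show ?thesis by (simp add: order_def MonoidAut_def)
qed

section \<open>Realizing a given ratio\<close>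

lemma fact_add_4_multiple:
  fixes a :: nat
  assumes "0 < a"
  obtains k where "fact (a + 4) = a * k" and "a + 6 \<le> k"
proof -
  have "a dvd fact (a + 4)" using assms by (intro dvd_fact) auto
  then obtain k where k: "fact (a + 4) = a * k" by (auto simp: dvd_def)
  have "2 \<le> (fact (a + 2) :: nat)" using fact_mono_nat[of 2 "a + 2"] by (simp add: fact_2)
  have "a * (a + 6) \<le> (a + 4) * ((a + 3) * 2)" by (simp add: algebra_simps)
  also have "\<dots> \<le> (a + 4) * ((a + 3) * fact (a + 2))"
    using \<open>2 \<le> fact (a + 2)\<close> by (intro mult_le_mono) auto
  also have "\<dots> = a * k"
    using k by (simp add: numeral_eq_Suc algebra_simps)
  finally have "a + 6 \<le> k" using assms by simp
  with k show thesis by (rule that)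
qed

theorem theorem1p2:
  fixes r :: rat
  assumes "0 < r"
  shows "(\<exists>M :: nat monoid. monoid M \<and> finite (carrier M) \<and>
            r = of_nat (order (MonoidAut M)) / of_nat (order M)) \<and>
         (\<exists>M :: nat monoid. comm_monoid M \<and> finite (carrier M) \<and>
            r = of_nat (order (MonoidAut M)) / of_nat (order M))"
proof -
  obtain i j where ij: "r = Fract i j" "0 < j" by (cases r) auto
  define a b where "a = nat i" and "b = nat j"
  have "0 < i" using assms ij by (simp add: zero_less_Fract_iff)
  then have a: "0 < a" and b: "0 < b" and r: "r = of_nat a / of_nat b"
    using ij by (simp_all add: a_def b_def Fract_of_int_quotient)
  obtain k where k: "fact (a + 4) = a * k" "a + 6 \<le> k"
    using fact_add_4_multiple[OF a] .
  let ?M = "antichain_monoid (a + 4) (b * k)"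
  have "k \<le> b * k" using b by simp
  then have N: "(a + 4) + 2 \<le> b * k" using k(2) by linarith
  have cm: "comm_monoid ?M" by (rule comm_monoid_antichain_monoid[OF N])
  then have m: "monoid ?M" by (rule comm_monoid.axioms)
  have "order (MonoidAut ?M) = a * k"
    using order_MonoidAut_antichain_monoid[OF _ N] k(1) by simp
  moreover have "order ?M = b * k" by (simp add: order_def)
  ultimately have "r = of_nat (order (MonoidAut ?M)) / of_nat (order ?M)"
    using r k(2) by simp
  moreover have "finite (carrier ?M)" by simp
  ultimately show ?thesis using cm m by blast
qed

end
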